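(* Let $S(t)$, $t\in\mathbb{N}_0$, be the simple symmetric random walk on $\mathbb{Z}$ with $S(0)=0$, and let $Z(t)=S(t)+i\widetilde S(t)$, $t\in\mathbb{N}_0$. Assume that $f$ is a polynomial. Then $\widetilde{\mathrm{E}}[f(Z(t))]$ is a martingale with discrete time $t\in\mathbb{N}_0$.
   Context: $\mathbb{N}_0=\{0,1,2,\dots\}$. Write $S(t)=\zeta(1)+\cdots+\zeta(t)$ with $\zeta(1),\zeta(2),\dots$ i.i.d. taking values $\pm1$ with probability $1/2$ each; "martingale" means martingale with respect to the filtration generated by $\{\zeta(1),\dots,\zeta(t)\}$. The process $\widetilde S$ is independent of $S$, with $\widetilde S(0)=0$ and $\widetilde S(t)=\widetilde\zeta(1)+\cdots+\widetilde\zeta(t)$, where $\widetilde\zeta(1),\widetilde\zeta(2),\dots$ are i.i.d. real random variables with the hyperbolic secant density $\frac{1}{2\cosh(\pi x/2)}$. $\widetilde{\mathrm{E}}$ denotes expectation with respect to $\widetilde S$ only (with $S$ kept fixed), so $\widetilde{\mathrm{E}}[f(Z(t))]$ is a function of $t$ and $S(t)$. *)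

theory Defs
  imports "HOL-Probability.Probability" "HOL-Computational_Algebra.Polynomial"
begin

text \<open>Steps are indexed from 1, as in the partial sum \<open>X(1) + \<dots> + X(t)\<close>; the value \<open>X 0\<close> is never used.\<close>

definition walk :: "(nat \<Rightarrow> 'a \<Rightarrow> 'b::comm_monoid_add) \<Rightarrow> nat \<Rightarrow> 'a \<Rightarrow> 'b" where
  "walk X t \<omega> = (\<Sum>k = 1..t. X k \<omega>)"

definition sech_density :: "real \<Rightarrow> real" where
  "sech_density x = 1 / (2 * cosh (pi * x / 2))"

text \<open>The sigma-algebra generated by \<open>X 1, \<dots>, X t\<close> (trivial for \<open>t = 0\<close>), for discrete random variables.\<close>

definition generated_filtration ::
  "'a measure \<Rightarrow> (nat \<Rightarrow> 'a \<Rightarrow> int) \<Rightarrow> nat \<Rightarrow> 'a measure" where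
  "generated_filtration M X t =
     sigma (space M) {X k -` A \<inter> space M | k A. k \<in> {1..t}}"

text \<open>The library has conditional expectations of real random variables only.\<close>

definition complex_cond_exp ::
  "'a measure \<Rightarrow> 'a measure \<Rightarrow> ('a \<Rightarrow> complex) \<Rightarrow> 'a \<Rightarrow> complex" where
  "complex_cond_exp M F X \<omega> =
     Complex (real_cond_exp M F (\<lambda>\<eta>. Re (X \<eta>)) \<omega>) (real_cond_exp M F (\<lambda>\<eta>. Im (X \<eta>)) \<omega>)"

definition complex_martingale ::
  "'a measure \<Rightarrow> (nat \<Rightarrow> 'a measure) \<Rightarrow> (nat \<Rightarrow> 'a \<Rightarrow> complex) \<Rightarrow> bool" where
  "complex_martingale M F X \<longleftrightarrow>
     filtration (space M) F \<and> (\<forall>t. subalgebra M (F t)) \<and>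
     (\<forall>t. X t \<in> borel_measurable (F t)) \<and>
     (\<forall>t. integrable M (X t)) \<and>
     (\<forall>s t. s \<le> t \<longrightarrow> (AE \<omega> in M. complex_cond_exp M (F s) (X t) \<omega> = X s \<omega>))"

text \<open>The expectation of \<open>f (S t + \<i> * T t)\<close> with respect to \<open>T\<close> only: the value of \<open>S t\<close> is frozen
  at \<open>\<omega>\<close>, and only the argument \<open>\<eta>\<close> of \<open>T t\<close> is integrated.\<close>

definition expectation_tilde ::
  "'a measure \<Rightarrow> (nat \<Rightarrow> 'a \<Rightarrow> int) \<Rightarrow> (nat \<Rightarrow> 'a \<Rightarrow> real) \<Rightarrow> (complex \<Rightarrow> complex) \<Rightarrow> nat \<Rightarrow> 'a \<Rightarrow> complex" where
  "expectation_tilde M S T f t \<omega> =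
     (\<integral>\<eta>. f (of_int (S t \<omega>) + \<i> * complex_of_real (T t \<eta>)) \<partial>M)"

end

theory Submission
  imports Defs "HOL-Complex_Analysis.Complex_Analysis" "HOL-Real_Asymp.Real_Asymp"
begin

text \<open>Let \<open>X\<close> have the hyperbolic secant density. The key identity is
  \<open>E[p(1 + \<i>X)] + E[p(-1 + \<i>X)] = 2 p(0)\<close> for every polynomial \<open>p\<close>. On the lines \<open>Re w = 1\<close> and
  \<open>Re w = -1\<close> the density equals \<open>1 / (2 sin(\<pi>w/2))\<close> and \<open>-1 / (2 sin(\<pi>w/2))\<close> respectively, so
  the left-hand side is the difference of the integrals of \<open>p(w) / (2 sin(\<pi>w/2))\<close> over the two
  lines; if \<open>p(0) = 0\<close>, this function is holomorphic in the strip \<open>-2 < Re w < 2\<close> and decays at infinity, so the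
  difference vanishes. Expanding \<open>f\<close> by the binomial theorem and using independence, the identity
  gives \<open>(G(t+1, x+1) + G(t+1, x-1)) / 2 = G(t, x)\<close> for \<open>G(t, x) = E[f(x + \<i> S'(t))]\<close>, which is the
  martingale property for the simple random walk.\<close>

subsection \<open>The hyperbolic secant density\<close>

lemma sech_density_nonneg [simp]: "0 \<le> sech_density x"
  by (simp add: sech_density_def)

lemma borel_measurable_sech_density [measurable]: "sech_density \<in> borel_measurable borel"
proof -
  have "continuous_on UNIV sech_density"
    unfolding sech_density_def[abs_def] by (intro continuous_intros) (auto simp: cosh_real_nonzero)
  then show ?thesis
    by (rule borel_measurable_continuous_onI)
qed

text \<open>A single term of the exponential series, all of whose terms are nonnegative here, is at
  most the whole sum.\<close>

lemma power_le_fact_exp: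
  fixes y :: real
  assumes "0 \<le> y"
  shows "y ^ n \<le> fact n * exp y"
proof -
  have s: "summable (\<lambda>k. inverse (fact k) * y ^ k)"
    by (rule summable_exp)
  have "inverse (fact n) * y ^ n = (\<Sum>k\<in>{n}. inverse (fact k) * y ^ k)"
    by simp
  also have "\<dots> \<le> (\<Sum>k. inverse (fact k) * y ^ k)"
    using assms by (intro sum_le_suminf s) auto
  also have "\<dots> = exp y"
    by (simp add: exp_def divide_inverse mult.commute)
  finally show ?thesis
    by (simp add: field_simps)
qed

text \<open>As pi/2 is at least 1, the density is at most exp(-|x|). The exponential absorbs the
  powers n and n + 2 together, which leaves a constant multiple of the integrable function 1/(1 +
  x^2).\<close>

lemma integrable_sech_density_power: "integrable lborel (\<lambda>x. sech_density x * x ^ n)"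
proof (rule Bochner_Integration.integrable_bound)
  have "integrable lborel (\<lambda>x::real. inverse (1 + x\<^sup>2))"
    using integrable_inverse_1_plus_square by (simp add: set_integrable_def)
  then show "integrable lborel (\<lambda>x::real. (fact n + fact (n + 2)) * inverse (1 + x\<^sup>2))"
    by simp
  show "AE x in lborel. norm (sech_density x * x ^ n)
      \<le> norm ((fact n + fact (n + 2)) * inverse (1 + x\<^sup>2))"
  proof (rule AE_I2)
    fix x :: real
    have "exp \<bar>x\<bar> \<le> exp \<bar>pi * x / 2\<bar>"
      using mult_right_mono[OF pi_ge_two, of "\<bar>x\<bar>"] by (simp add: abs_mult mult.commute)
    also have "\<dots> \<le> 2 * cosh \<bar>pi * x / 2\<bar>"
      by (simp add: cosh_def)
    finally have e: "exp \<bar>x\<bar> \<le> 2 * cosh (pi * x / 2)"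
      by (simp add: cosh_real_abs del: abs_divide abs_mult)
    have "(1 + x\<^sup>2) * \<bar>x\<bar> ^ n = \<bar>x\<bar> ^ n + \<bar>x\<bar> ^ (n + 2)"
      by (simp add: algebra_simps power_add power2_eq_square)
    also have "\<dots> \<le> (fact n + fact (n + 2)) * exp \<bar>x\<bar>"
      unfolding distrib_right by (intro add_mono power_le_fact_exp abs_ge_zero)
    also have "\<dots> \<le> (fact n + fact (n + 2)) * (2 * cosh (pi * x / 2))"
      using e by (intro mult_left_mono) (auto intro: add_nonneg_nonneg)
    finally have "(1 + x\<^sup>2) * \<bar>x\<bar> ^ n \<le> (fact n + fact (n + 2)) * (2 * cosh (pi * x / 2))" .
    moreover have "0 < 1 + x\<^sup>2" "0 < 2 * cosh (pi * x / 2)"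
      by (simp_all add: add_pos_nonneg cosh_real_pos)
    ultimately have "\<bar>x\<bar> ^ n / (2 * cosh (pi * x / 2)) \<le> (fact n + fact (n + 2)) / (1 + x\<^sup>2)"
      by (simp only: pos_divide_le_eq pos_le_divide_eq times_divide_eq_left mult.commute[of "1 + x\<^sup>2"])
    also have "\<bar>x\<bar> ^ n / (2 * cosh (pi * x / 2)) = norm (sech_density x * x ^ n)"
      by (simp add: sech_density_def abs_mult power_abs)
    also have "(fact n + fact (n + 2)) / (1 + x\<^sup>2) \<le> norm ((fact n + fact (n + 2)) * inverse (1 + x\<^sup>2))"
      unfolding divide_inverse real_norm_def by (rule abs_ge_self)
    finally show "norm (sech_density x * x ^ n) \<le> norm ((fact n + fact (n + 2)) * inverse (1 + x\<^sup>2))" .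
  qed
  show "(\<lambda>x. sech_density x * x ^ n) \<in> borel_measurable lborel"
    by measurable
qed

text \<open>Composition with \<open>[:c, \<i>:]\<close> gives a polynomial in the real variable, so
  integrability along a vertical line reduces to integrability of real moments.\<close>

lemma poly_of_linear_real:
  "poly p (c + \<i> * complex_of_real x)
    = (\<Sum>i\<le>degree (pcompose p [:c, \<i>:]). coeff (pcompose p [:c, \<i>:]) i * complex_of_real (x ^ i))"
proof -
  have "poly p (c + \<i> * complex_of_real x) = poly (pcompose p [:c, \<i>:]) (complex_of_real x)"
    by (simp add: poly_pcompose mult.commute)
  then show ?thesis
    by (simp add: poly_altdef)
qed

lemma integrable_poly_of_moments:
  fixes X :: "'a \<Rightarrow> real"
  assumes "\<And>n. integrable M (\<lambda>\<omega>. X \<omega> ^ n)"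
  shows "integrable M (\<lambda>\<omega>. poly p (c + \<i> * complex_of_real (X \<omega>)))"
  unfolding poly_of_linear_real
  by (intro Bochner_Integration.integrable_sum integrable_mult_right integrable_of_real assms)

lemma integrable_sech_density_poly:
  "integrable lborel (\<lambda>x. complex_of_real (sech_density x) * poly p (c + \<i> * complex_of_real x))"
proof -
  have "integrable lborel (\<lambda>x. coeff (pcompose p [:c, \<i>:]) i * complex_of_real (sech_density x * x ^ i))" for i
    by (intro integrable_mult_right integrable_of_real integrable_sech_density_power)
  then show ?thesis
    unfolding poly_of_linear_real sum_distrib_left
    by (intro Bochner_Integration.integrable_sum) (simp add: mult_ac)
qed

section \<open>Growth bounds and zeros on the strip, and the kernel w / sin(pi w/2)\<close>

lemma norm_poly_le: "norm (poly p z) \<le> (\<Sum>i\<le>degree p. norm (coeff p i) * norm z ^ i)"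
  for z :: "'a::real_normed_field"
  unfolding poly_altdef by (rule order_trans[OF norm_sum]) (simp add: norm_mult norm_power)

text \<open>This is |sin(x + iy)|^2 = sin(x)^2 + sinh(y)^2 with the first square dropped. Only the
  absolute value of the imaginary part is prescribed, so one bound serves both half-planes.\<close>

lemma sinh_le_norm_sin:
  assumes "0 \<le> y" "\<bar>Im z\<bar> = y"
  shows "sinh y \<le> cmod (sin z)"
proof -
  have "sinh y ^ 2 = sinh (Im z) ^ 2"
    using assms by (auto simp: abs_if split: if_splits)
  also have "\<dots> = (exp (2 * Im z) + inverse (exp (2 * Im z)) - 2) / 4"
    unfolding exp_double sinh_field_def exp_minus
    by (simp add: power2_eq_square field_simps)
  also have "\<dots> \<le> cmod (sin z) ^ 2"
    by (simp add: norm_sin_squared)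
  finally show ?thesis
    by (rule power2_le_imp_le) simp
qed

text \<open>The zeros of sin(pi w/2) are the even integers; the strip ends where the next ones, 2
  and -2, lie.\<close>

lemma sin_half_pi_eq_0_strip:
  assumes "\<bar>Re w\<bar> < 2" "sin (of_real pi * w / 2) = 0"
  shows "w = 0"
proof -
  obtain n :: int where "of_real pi * w / 2 = of_real (n * pi)"
    using assms(2) by (auto simp: sin_eq_0)
  then have w: "w = of_real (2 * n)"
    by (simp add: field_simps)
  then have "\<bar>2 * n\<bar> < 2"
    using assms(1) by simp
  then show ?thesis
    using w by simp
qed

text \<open>Exponential growth beats polynomial growth. This makes the horizontal sides of the
  rectangles negligible.\<close>

lemma poly_over_sinh_tendsto_0:
  "(\<lambda>n. (\<Sum>i\<le>m. a i * (1 + real n) ^ i) / sinh (pi * real n / 2)) \<longlonglongrightarrow> 0"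
proof -
  have "(\<lambda>n. (1 + real n) ^ i / sinh (pi * real n / 2)) \<longlonglongrightarrow> 0" for i
    unfolding sinh_field_def by real_asymp
  then have "(\<lambda>n. \<Sum>i\<le>m. a i * ((1 + real n) ^ i / sinh (pi * real n / 2))) \<longlonglongrightarrow> (\<Sum>i\<le>m. a i * 0)"
    by (intro tendsto_intros)
  then show ?thesis
    by (simp add: sum_divide_distrib)
qed

text \<open>The value at 0 fills the removable singularity of w / sin(pi w/2).\<close>

definition sin_kernel :: "complex \<Rightarrow> complex" where
  "sin_kernel w = (if w = 0 then 2 / of_real pi else w / sin (of_real pi * w / 2))"

text \<open>The origin may be left out: the theorem that later yields a primitive asks only for
  continuity at finitely many exceptional points.\<close>

lemma field_differentiable_sin_kernel:
  assumes "\<bar>Re w\<bar> < 2" "w \<noteq> 0"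
  shows "sin_kernel field_differentiable at w"
proof -
  have "(\<lambda>w. w / sin (of_real pi * w / 2)) holomorphic_on {w. \<bar>Re w\<bar> < 2} - {0}"
    using sin_half_pi_eq_0_strip by (intro holomorphic_intros) auto
  then have "sin_kernel holomorphic_on {w. \<bar>Re w\<bar> < 2} - {0}"
    by (rule holomorphic_transform) (auto simp: sin_kernel_def)
  moreover have "open ({w. \<bar>Re w\<bar> < 2} - {0})"
    by (intro open_Diff open_Collect_less continuous_intros)
  ultimately show ?thesis
    using assms by (auto intro: holomorphic_on_imp_differentiable_at)
qed

text \<open>At the origin, sin(pi w/2) / w is a difference quotient with limit pi/2, the derivative
  of the sine term; the kernel is its reciprocal.\<close>

lemma isCont_sin_kernel:
  assumes "\<bar>Re w\<bar> < 2"
  shows "isCont sin_kernel w"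
proof (cases "w = 0")
  case True
  have "((\<lambda>w. sin (of_real pi * w / 2)) has_field_derivative of_real pi / 2) (at (0::complex))"
    by (auto intro!: derivative_eq_intros)
  then have "((\<lambda>w. sin (of_real pi * w / 2) / w) \<longlongrightarrow> complex_of_real pi / 2) (at 0)"
    by (simp add: has_field_derivative_iff)
  then have "((\<lambda>w. inverse (sin (of_real pi * w / 2) / w)) \<longlongrightarrow> inverse (complex_of_real pi / 2)) (at 0)"
    by (rule tendsto_inverse) simp
  then have "((\<lambda>w. inverse (sin (of_real pi * w / 2) / w)) \<longlongrightarrow> 2 / complex_of_real pi) (at 0)"
    by simp
  then have "(sin_kernel \<longlongrightarrow> 2 / complex_of_real pi) (at 0)"
    by (rule Lim_transform_eventually) (simp add: sin_kernel_def eventually_at_filter)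
  then show ?thesis
    using True by (simp add: isCont_def sin_kernel_def)
next
  case False
  then show ?thesis
    using assms field_differentiable_imp_continuous_at field_differentiable_sin_kernel by blast
qed

lemma cos_i_times_of_real: "cos (\<i> * of_real x) = complex_of_real (cosh x)"
  by (simp add: cosh_conv_cos[symmetric] cosh_field_def exp_of_real[symmetric])

text \<open>The shift by pi/2 turns the sine into a hyperbolic cosine: sin(pi/2 + iy) =
  cosh(y).\<close>

lemma sin_kernel_right: "sin_kernel (1 + \<i> * of_real x) = 2 * of_real (sech_density x) * (1 + \<i> * of_real x)"
proof -
  have "1 + \<i> * complex_of_real x \<noteq> 0"
    by (simp add: complex_eq_iff)
  moreover have "sin (of_real pi * (1 + \<i> * complex_of_real x) / 2)
      = sin (\<i> * of_real (pi * x / 2) + of_real pi / 2)"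
    by (simp add: algebra_simps add_divide_distrib)
  moreover have "\<dots> = of_real (cosh (pi * x / 2))"
    by (simp add: sin_add cos_i_times_of_real del: of_real_mult of_real_divide)
  ultimately show ?thesis
    by (simp add: sin_kernel_def sech_density_def)
qed

text \<open>Here sin(-pi/2 + iy) = -cosh(y). This sign makes the difference of the two line
  integrals a sum of expectations.\<close>

lemma sin_kernel_left: "sin_kernel (-1 + \<i> * of_real x) = - 2 * of_real (sech_density x) * (-1 + \<i> * of_real x)"
proof -
  have "-1 + \<i> * complex_of_real x \<noteq> 0"
    by (simp add: complex_eq_iff)
  moreover have "sin (of_real pi * (-1 + \<i> * complex_of_real x) / 2)
      = sin (\<i> * of_real (pi * x / 2) - of_real pi / 2)"
    by (simp add: algebra_simps diff_divide_distrib)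
  moreover have "\<dots> = - of_real (cosh (pi * x / 2))"
    by (simp add: sin_diff cos_i_times_of_real del: of_real_mult of_real_divide)
  ultimately show ?thesis
    by (simp add: sin_kernel_def sech_density_def)
qed

section \<open>Shifting the line of integration from Re w = 1 to Re w = -1\<close>

text \<open>The fundamental theorem of calculus along w = c + ix; the factor \<open>- \<i>\<close>
  is 1/i, from dw = i dx.\<close>

lemma integral_vertical_line:
  assumes P: "\<And>w. \<bar>Re w\<bar> < 2 \<Longrightarrow> (P has_field_derivative G w) (at w)"
    and G: "\<And>w. \<bar>Re w\<bar> < 2 \<Longrightarrow> isCont G w" and "\<bar>c\<bar> < 2" "0 \<le> r"
  shows "(\<integral>x. indicator {-r..r} x *\<^sub>R G (of_real c + \<i> * of_real x) \<partial>lborel)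
    = - \<i> * (P (of_real c + \<i> * of_real r) - P (of_real c - \<i> * of_real r))"
proof -
  have "(\<integral>x. indicator {-r..r} x *\<^sub>R G (of_real c + \<i> * of_real x) \<partial>lborel)
      = - \<i> * P (of_real c + \<i> * of_real r) - - \<i> * P (of_real c + \<i> * of_real (-r))"
  proof (rule integral_FTC_atLeastAtMost)
    fix x
    have "((\<lambda>z. P (of_real c + \<i> * z)) has_field_derivative G (of_real c + \<i> * of_real x) * \<i>) (at (of_real x))"
      by (rule DERIV_chain2[OF P]) (use assms in \<open>auto intro!: derivative_eq_intros\<close>)
    then have "((\<lambda>z. - \<i> * P (of_real c + \<i> * z)) has_field_derivative G (of_real c + \<i> * of_real x)) (at (of_real x))"
      by (rule DERIV_cmult[where c = "- \<i>", THEN DERIV_cong]) (simp add: mult.commute)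
    then show "((\<lambda>x. - \<i> * P (of_real c + \<i> * of_real x)) has_vector_derivative
        G (of_real c + \<i> * of_real x)) (at x within {-r..r})"
      by (rule has_vector_derivative_real_field)
  next
    have "isCont (\<lambda>x. G (of_real c + \<i> * of_real x)) x" for x
      by (rule isCont_o2[OF _ G]) (use assms in \<open>auto intro!: continuous_intros\<close>)
    then show "continuous_on {-r..r} (\<lambda>x. G (of_real c + \<i> * of_real x))"
      by (simp add: continuous_at_imp_continuous_on)
  qed (use \<open>0 \<le> r\<close> in simp)
  then show ?thesis
    by (simp add: algebra_simps)
qed

text \<open>Dominated convergence with majorant |h|: at each point the truncated function equals
  \<open>h\<close> from some \<open>n\<close> on.\<close>

lemma tendsto_integral_symmetric_interval:
  fixes h :: "real \<Rightarrow> 'b::{banach, second_countable_topology}"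
  assumes "integrable lborel h"
  shows "(\<lambda>n. \<integral>x. indicator {- real n..real n} x *\<^sub>R h x \<partial>lborel) \<longlonglongrightarrow> (\<integral>x. h x \<partial>lborel)"
proof (rule integral_dominated_convergence)
  show "AE x in lborel. (\<lambda>n. indicator {- real n..real n} x *\<^sub>R h x) \<longlonglongrightarrow> h x"
  proof (rule AE_I2, rule tendsto_eventually)
    fix x :: real
    obtain N :: nat where "\<bar>x\<bar> \<le> real N"
      using real_arch_simple by blast
    then show "\<forall>\<^sub>F n in sequentially. indicator {- real n..real n} x *\<^sub>R h x = h x"
      by (intro eventually_sequentiallyI[of N]) (auto simp: indicator_def)
  qed
  show "AE x in lborel. norm (indicator {- real n..real n} x *\<^sub>R h x) \<le> norm (h x)" for n
    by (auto simp: indicator_def)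
  show "h \<in> borel_measurable lborel"
    using assms by simp
  then show "(\<lambda>x. indicator {- real n..real n} x *\<^sub>R h x) \<in> borel_measurable lborel" for n
    by measurable
  show "integrable lborel (\<lambda>x. norm (h x))"
    using assms by (rule integrable_norm)
qed

text \<open>The mean value inequality on a segment of length 2 at height \<open>y\<close>. On it |w|
  is at most 1 + n, while the sine in the denominator has modulus at least sinh(pi n/2).\<close>

lemma norm_diff_horizontal_segment_le:
  assumes P: "\<And>w. \<bar>Re w\<bar> < 2 \<Longrightarrow> (P has_field_derivative poly r w * sin_kernel w) (at w)"
    and y: "\<bar>y\<bar> = real n" "0 < n"
  shows "cmod (P (1 + \<i> * of_real y) - P (-1 + \<i> * of_real y))
    \<le> 2 * ((\<Sum>i\<le>degree (pCons 0 r). cmod (coeff (pCons 0 r) i) * (1 + real n) ^ i) / sinh (pi * real n / 2))"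
    (is "_ \<le> 2 * ?B")
proof -
  let ?L = "closed_segment (-1 + \<i> * of_real y) (1 + \<i> * complex_of_real y)"
  have L: "\<bar>Re w\<bar> \<le> 1" "Im w = y" if "w \<in> ?L" for w
    using that by (auto simp: closed_segment_same_Im closed_segment_eq_real_ivl)
  have "cmod (P (1 + \<i> * of_real y) - P (-1 + \<i> * of_real y))
      \<le> ?B * cmod ((1 + \<i> * of_real y) - (-1 + \<i> * of_real y))"
  proof (rule field_differentiable_bound)
    fix w assume w: "w \<in> ?L"
    show "(P has_field_derivative poly r w * sin_kernel w) (at w within ?L)"
      using L[OF w] by (intro has_field_derivative_at_within[OF P]) auto
    \<comment> \<open>Since \<open>n\<close> is positive, the segment avoids the origin, so the
      kernel is given by its quotient formula.\<close>
    have nz: "w \<noteq> 0"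
      using L[OF w] y by auto
    have "sinh (pi * real n / 2) \<le> cmod (sin (of_real pi * w / 2))"
      using L[OF w] y by (intro sinh_le_norm_sin) (auto simp: abs_mult)
    moreover have "0 < sinh (pi * real n / 2)"
      using y by (simp add: sinh_real_pos_iff)
    moreover have "cmod w \<le> 1 + real n"
      using cmod_le[of w] L[OF w] y by simp
    then have "cmod (poly (pCons 0 r) w)
        \<le> (\<Sum>i\<le>degree (pCons 0 r). cmod (coeff (pCons 0 r) i) * (1 + real n) ^ i)"
      by (intro order_trans[OF norm_poly_le] sum_mono mult_left_mono power_mono) auto
    \<comment> \<open>The polynomial \<open>pCons 0 r\<close> is w times \<open>r\<close>, and this
      factor w is the numerator of the kernel.\<close>
    moreover have "poly r w * sin_kernel w = poly (pCons 0 r) w / sin (of_real pi * w / 2)"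
      using nz by (simp add: sin_kernel_def)
    ultimately show "cmod (poly r w * sin_kernel w) \<le> ?B"
      by (simp only: norm_divide) (rule frac_le; simp add: sum_nonneg)
  qed auto
  then show ?thesis
    by (simp add: mult.commute)
qed

text \<open>The constant term of the polynomial is split off because the remaining integrand
  \<open>poly r w * sin_kernel w\<close> has no pole inside the strip, so no residue is needed.\<close>

lemma integral_sech_density_no_constant_term:
  "(\<integral>x. of_real (sech_density x) * poly (pCons 0 r) (1 + \<i> * of_real x) \<partial>lborel)
    + (\<integral>x. of_real (sech_density x) * poly (pCons 0 r) (-1 + \<i> * of_real x) \<partial>lborel) = 0"
proof -
  let ?q = "pCons 0 r" and ?G = "\<lambda>w. poly r w * sin_kernel w"
  let ?S = "{w. \<bar>Re w\<bar> < 2}"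
  have cont: "isCont ?G w" if "\<bar>Re w\<bar> < 2" for w
    using isCont_sin_kernel[OF that] by (intro continuous_intros)
  have S: "open ?S" "convex ?S"
  proof -
    show "open ?S"
      by (intro open_Collect_less continuous_intros)
    have "?S = {w. Re w < 2} \<inter> {w. Re w > -2}"
      by auto
    then show "convex ?S"
      by (simp add: convex_Int convex_halfspace_Re_lt convex_halfspace_Re_gt)
  qed
  \<comment> \<open>A primitive on the convex strip takes the place of Cauchy's theorem for
    rectangles; 0 is the exceptional point where continuity suffices.\<close>
  obtain P where "(P has_field_derivative ?G w) (at w within ?S)" if "w \<in> ?S" for w
  proof (rule holomorphic_convex_primitive[of ?S "{0}" ?G])
    show "continuous_on ?S ?G"
      using cont by (intro continuous_at_imp_continuous_on) auto
    show "?G field_differentiable at w" if "w \<in> interior ?S - {0}" for w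
      using that field_differentiable_sin_kernel[of w] S
      by (intro field_differentiable_mult) (auto simp: interior_open field_differentiable_def intro: poly_DERIV)
  qed (use S in auto)
  then have P: "(P has_field_derivative ?G w) (at w)" if "\<bar>Re w\<bar> < 2" for w
    using that S by (metis at_within_open mem_Collect_eq)
  define B where "B n = (\<Sum>i\<le>degree ?q. cmod (coeff ?q i) * (1 + real n) ^ i) / sinh (pi * real n / 2)" for n
  define I where "I c = (\<integral>x. ?G (of_real c + \<i> * of_real x) \<partial>lborel)" for c :: real
  define J where "J c n = (\<integral>x. indicator {- real n..real n} x *\<^sub>R ?G (of_real c + \<i> * of_real x) \<partial>lborel)"
    for c :: real and n
  \<comment> \<open>The factors 2 and -2 cancel the 1/2 in the density.\<close>
  have G1: "?G (of_real 1 + \<i> * of_real x) = 2 * (of_real (sech_density x) * poly ?q (1 + \<i> * of_real x))"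
    and G2: "?G (of_real (-1) + \<i> * of_real x) = - 2 * (of_real (sech_density x) * poly ?q (-1 + \<i> * of_real x))" for x
    unfolding of_real_minus of_real_1 sin_kernel_right sin_kernel_left by (simp_all add: mult_ac)
  have "(\<lambda>n. J 1 n - J (-1) n) \<longlonglongrightarrow> I 1 - I (-1)"
    unfolding I_def J_def G1 G2
    by (intro tendsto_diff tendsto_integral_symmetric_interval integrable_mult_right integrable_sech_density_poly)
  moreover have "(\<lambda>n. J 1 n - J (-1) n) \<longlonglongrightarrow> 0"
  proof (rule Lim_null_comparison)
    show "\<forall>\<^sub>F n in sequentially. cmod (J 1 n - J (-1) n) \<le> 4 * B n"
    proof (rule eventually_sequentiallyI[of 1])
      fix n :: nat assume n: "1 \<le> n"
      have J: "J c n = - \<i> * (P (of_real c + \<i> * of_real (real n)) - P (of_real c - \<i> * of_real (real n)))" if "\<bar>c\<bar> < 2" for c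
        unfolding J_def using integral_vertical_line[OF P cont, of c "real n"] that by simp
      \<comment> \<open>The values of \<open>P\<close> at the four corners of the rectangle are
        regrouped: two vertical differences become one along the top side and one along the bottom
        side.\<close>
      have "J 1 n - J (-1) n = - \<i> * ((P (1 + \<i> * of_real (real n)) - P (-1 + \<i> * of_real (real n)))
          - (P (1 + \<i> * of_real (- real n)) - P (-1 + \<i> * of_real (- real n))))"
        using J[of 1] J[of "-1"] by (simp only: of_real_1 of_real_minus abs_minus_cancel abs_one) (simp add: algebra_simps)
      then have "cmod (J 1 n - J (-1) n)
          \<le> cmod (P (1 + \<i> * of_real (real n)) - P (-1 + \<i> * of_real (real n)))
            + cmod (P (1 + \<i> * of_real (- real n)) - P (-1 + \<i> * of_real (- real n)))"
        by (simp only: norm_mult norm_minus_cancel norm_ii mult_1 norm_triangle_ineq4)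
      also have "\<dots> \<le> 2 * B n + 2 * B n"
        unfolding B_def using n
        by (intro add_mono norm_diff_horizontal_segment_le[OF P]) auto
      finally show "cmod (J 1 n - J (-1) n) \<le> 4 * B n"
        by simp
    qed
    show "(\<lambda>n. 4 * B n) \<longlonglongrightarrow> 0"
      unfolding B_def by (rule tendsto_mult_right_zero, rule poly_over_sinh_tendsto_0)
  qed
  ultimately have "I 1 - I (-1) = 0"
    by (rule LIMSEQ_unique)
  then have "2 * (\<integral>x. of_real (sech_density x) * poly ?q (1 + \<i> * of_real x) \<partial>lborel)
      - - 2 * (\<integral>x. of_real (sech_density x) * poly ?q (-1 + \<i> * of_real x) \<partial>lborel) = 0"
    by (simp only: I_def G1 G2 integral_mult_right_zero)
  then show ?thesis
    by (simp only: mult_minus_left diff_minus_eq_add distrib_left[symmetric] mult_eq_0_iff) simp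
qed

section \<open>Expectations under the hyperbolic secant law\<close>

context prob_space
begin

lemma integrable_sech_power:
  assumes "distributed M lborel X (\<lambda>x. ennreal (sech_density x))"
  shows "integrable M (\<lambda>\<omega>. X \<omega> ^ n)"
  using distributed_integrable[OF assms, of "\<lambda>x. x ^ n"] integrable_sech_density_power by simp

lemma integrable_sech_poly:
  assumes "distributed M lborel X (\<lambda>x. ennreal (sech_density x))"
  shows "integrable M (\<lambda>\<omega>. poly p (c + \<i> * complex_of_real (X \<omega>)))"
  by (rule integrable_poly_of_moments[OF integrable_sech_power[OF assms]])

lemma expectation_sech:
  fixes g :: "real \<Rightarrow> complex"
  assumes X: "distributed M lborel X (\<lambda>x. ennreal (sech_density x))" and [measurable]: "g \<in> borel_measurable borel"
  shows "(\<integral>\<omega>. g (X \<omega>) \<partial>M) = (\<integral>x. of_real (sech_density x) * g x \<partial>lborel)"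
proof -
  have "X \<in> borel_measurable M"
    using distributed_measurable[OF X] by simp
  then have "(\<integral>\<omega>. g (X \<omega>) \<partial>M) = integral\<^sup>L (distr M lborel X) g"
    by (simp add: integral_distr)
  also have "\<dots> = (\<integral>x. sech_density x *\<^sub>R g x \<partial>lborel)"
    by (simp add: distributed_distr_eq_density[OF X] integral_density)
  finally show ?thesis
    by (simp add: scaleR_conv_of_real)
qed

text \<open>The constant term \<open>a\<close>, which is p(0), contributes \<open>a\<close> to each
  expectation because \<open>M\<close> has total mass 1. The contributions of the remaining part
  cancel by the shift of the line of integration.\<close>

lemma expectation_sech_poly:
  assumes X: "distributed M lborel X (\<lambda>x. ennreal (sech_density x))"
  shows "(\<integral>\<omega>. poly p (1 + \<i> * of_real (X \<omega>)) \<partial>M) + (\<integral>\<omega>. poly p (-1 + \<i> * of_real (X \<omega>)) \<partial>M) = 2 * poly p 0"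
proof (cases p)
  case (pCons a r)
  have [measurable]: "(\<lambda>x. poly (pCons 0 r) (c + \<i> * complex_of_real x)) \<in> borel_measurable borel" for c
    by (intro borel_measurable_continuous_onI continuous_intros)
  let ?q = "pCons 0 r"
  have E: "(\<integral>\<omega>. poly p (c + \<i> * of_real (X \<omega>)) \<partial>M)
      = a + (\<integral>x. of_real (sech_density x) * poly ?q (c + \<i> * of_real x) \<partial>lborel)" for c
  proof -
    have "(\<integral>\<omega>. poly p (c + \<i> * of_real (X \<omega>)) \<partial>M)
        = (\<integral>\<omega>. a + poly ?q (c + \<i> * of_real (X \<omega>)) \<partial>M)"
      by (simp add: pCons)
    also have "\<dots> = (\<integral>\<omega>. a \<partial>M) + (\<integral>\<omega>. poly ?q (c + \<i> * of_real (X \<omega>)) \<partial>M)"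
      by (intro Bochner_Integration.integral_add integrable_sech_poly[OF X] integrable_const)
    also have "(\<integral>\<omega>. poly ?q (c + \<i> * of_real (X \<omega>)) \<partial>M)
        = (\<integral>x. of_real (sech_density x) * poly ?q (c + \<i> * of_real x) \<partial>lborel)"
      by (rule expectation_sech[OF X]) measurable
    finally show ?thesis
      by (simp add: prob_space)
  qed
  have "(a + u) + (a + v) = 2 * a" if "u + v = 0" for u v
    using that by (simp add: add_eq_0_iff2)
  from this[OF integral_sech_density_no_constant_term[of r]] show ?thesis
    unfolding E by (simp only: pCons poly_pCons mult_zero_left add_0_right)
qed

end

subsection \<open>Walks and generated filtrations\<close>

lemma walk_0 [simp]: "walk X 0 \<omega> = 0"
  by (simp add: walk_def)

lemma walk_Suc [simp]: "walk X (Suc t) \<omega> = walk X t \<omega> + X (Suc t) \<omega>"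
  by (simp add: walk_def)

lemma measurable_walk:
  fixes X :: "nat \<Rightarrow> 'a \<Rightarrow> int"
  assumes "\<And>k. k \<in> {1..t} \<Longrightarrow> X k \<in> measurable M (count_space UNIV)"
  shows "walk X t \<in> measurable M (count_space UNIV)"
  using assms
proof (induction t)
  case 0
  then show ?case
    by (simp add: walk_def[abs_def])
next
  case (Suc t)
  have X: "X (Suc t) \<in> measurable M (count_space UNIV)"
    using Suc.prems by simp
  \<comment> \<open>The previous sum takes countably many values, so it is enough to treat it as a
    constant \<open>i\<close>.\<close>
  have "(\<lambda>\<omega>. i + X (Suc t) \<omega>) \<in> measurable M (count_space UNIV)" for i
    by (rule measurable_compose[OF X]) simp
  moreover have "walk X t \<in> measurable M (count_space UNIV)"
    using Suc by simp
  ultimately have "(\<lambda>\<omega>. walk X t \<omega> + X (Suc t) \<omega>) \<in> measurable M (count_space UNIV)"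
    by (rule measurable_compose_countable)
  then show ?case
    by (simp add: walk_def[abs_def])
qed

lemma space_generated_filtration [simp]: "space (generated_filtration M X t) = space M"
  by (simp add: generated_filtration_def space_measure_of_conv)

lemma sets_generated_filtration:
  "sets (generated_filtration M X t) = sigma_sets (space M) {X k -` A \<inter> space M | k A. k \<in> {1..t}}"
  unfolding generated_filtration_def by (rule sets_measure_of) auto

lemma filtration_generated_filtration: "filtration (space M) (generated_filtration M X)"
proof
  fix i j :: nat assume "i \<le> j"
  then show "sets (generated_filtration M X i) \<subseteq> sets (generated_filtration M X j)"
    unfolding sets_generated_filtration
    by (intro sigma_sets_mono') fastforce
qed simp

lemma subalgebra_generated_filtration:
  assumes "\<And>k. k \<ge> 1 \<Longrightarrow> X k \<in> measurable M (count_space UNIV)"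
  shows "subalgebra M (generated_filtration M X t)"
  unfolding subalgebra_def sets_generated_filtration
  using assms by (auto intro!: sets.sigma_sets_subset measurable_sets)

lemma measurable_generated_filtration:
  assumes "k \<in> {1..t}"
  shows "X k \<in> measurable (generated_filtration M X t) (count_space UNIV)"
  by (rule measurableI) (use assms in \<open>auto simp: sets_generated_filtration intro!: sigma_sets.Basic\<close>)

text \<open>A Doob-Dynkin statement for events. It lets the indicator of \<open>A\<close> be written
  as a function of the vector of the first \<open>t\<close> steps, the form in which independence of
  the next step applies. The generators are preimages of cylinder sets, and all preimages under the
  vector map form a sigma-algebra.\<close>

lemma generated_filtration_vimage:
  assumes "A \<in> sets (generated_filtration M X t)"
  obtains A' where "A' \<in> sets (PiM {1..t} (\<lambda>_. count_space UNIV))"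
    "A = (\<lambda>\<omega>. restrict (\<lambda>k. X k \<omega>) {1..t}) -` A' \<inter> space M"
proof -
  let ?N = "PiM {1..t} (\<lambda>_. count_space UNIV) :: (nat \<Rightarrow> int) measure"
  let ?V = "\<lambda>\<omega>. restrict (\<lambda>k. X k \<omega>) {1..t}"
  have V: "?V \<in> space M \<rightarrow> space ?N"
    by (auto simp: space_PiM)
  have "sigma_sets (space M) {X k -` A \<inter> space M | k A. k \<in> {1..t}} \<subseteq> sets (vimage_algebra (space M) ?V ?N)"
  proof -
    have "X k -` B \<inter> space M \<in> sets (vimage_algebra (space M) ?V ?N)" if k: "k \<in> {1..t}" for k B
    proof -
      have "(\<lambda>v. v k) -` B \<inter> space ?N \<in> sets ?N"
        using k by (intro measurable_sets[OF measurable_component_singleton]) auto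
      moreover have "X k -` B \<inter> space M = ?V -` ((\<lambda>v. v k) -` B \<inter> space ?N) \<inter> space M"
        using k V by auto
      ultimately show ?thesis
        unfolding sets_vimage_algebra2[OF V] by blast
    qed
    then show ?thesis
      using sets.sigma_sets_subset[of "{X k -` A \<inter> space M | k A. k \<in> {1..t}}" "vimage_algebra (space M) ?V ?N"]
      by (simp only: space_vimage_algebra) blast
  qed
  then have "A \<in> sets (vimage_algebra (space M) ?V ?N)"
    using assms by (auto simp: sets_generated_filtration)
  then show ?thesis
    unfolding sets_vimage_algebra2[OF V] using that by blast
qed

section \<open>Independence and moments of walks\<close>

context prob_space
begin

lemma indep_var_compose_borel:
  assumes "indep_var borel X borel Y" "f \<in> borel_measurable borel" "g \<in> borel_measurable borel"
  shows "indep_var borel (\<lambda>\<omega>. f (X \<omega>)) borel (\<lambda>\<omega>. g (Y \<omega>))"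
  using indep_var_compose[OF assms(1), of f borel g borel] assms(2,3) by (simp add: o_def)

text \<open>The two variables are functions of the disjoint blocks of indices \<open>{1..t}\<close>
  and \<open>{Suc t}\<close>.\<close>

lemma indep_var_walk_step:
  fixes X :: "nat \<Rightarrow> 'a \<Rightarrow> real"
  assumes "indep_vars (\<lambda>_. borel) X {1..}"
  shows "indep_var borel (walk X t) borel (X (Suc t))"
proof -
  have "indep_var borel ((\<lambda>v. \<Sum>k = 1..t. v k) \<circ> (\<lambda>\<omega>. restrict (\<lambda>k. X k \<omega>) {1..t}))
      borel ((\<lambda>v. v (Suc t)) \<circ> (\<lambda>\<omega>. restrict (\<lambda>k. X k \<omega>) {Suc t}))"
    by (intro indep_var_compose[OF indep_var_restrict[OF assms]]) auto
  also have "(\<lambda>v. \<Sum>k = 1..t. v k) \<circ> (\<lambda>\<omega>. restrict (\<lambda>k. X k \<omega>) {1..t}) = walk X t"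
    by (auto simp: walk_def fun_eq_iff intro!: sum.cong)
  also have "(\<lambda>v. v (Suc t)) \<circ> (\<lambda>\<omega>. restrict (\<lambda>k. X k \<omega>) {Suc t}) = X (Suc t)"
    by (simp add: fun_eq_iff)
  finally show ?thesis .
qed

text \<open>Induction on \<open>t\<close> for all exponents at once: the binomial theorem produces
  products of lower powers, and products of independent integrable variables are integrable.\<close>

lemma integrable_walk_power:
  fixes X :: "nat \<Rightarrow> 'a \<Rightarrow> real"
  assumes X: "indep_vars (\<lambda>_. borel) X {1..}"
    and moments: "\<And>k n. k \<ge> 1 \<Longrightarrow> integrable M (\<lambda>\<omega>. X k \<omega> ^ n)"
  shows "integrable M (\<lambda>\<omega>. walk X t \<omega> ^ n)"
proof (induction t arbitrary: n)
  case (Suc t)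
  have "integrable M (\<lambda>\<omega>. walk X t \<omega> ^ k * X (Suc t) \<omega> ^ (n - k))" for k
    by (intro indep_var_integrable indep_var_compose_borel[OF indep_var_walk_step[OF X]] Suc.IH moments) auto
  then have "integrable M (\<lambda>\<omega>. \<Sum>k\<le>n. real (n choose k) * (walk X t \<omega> ^ k * X (Suc t) \<omega> ^ (n - k)))"
    by (intro Bochner_Integration.integrable_sum integrable_mult_right)
  then show ?case
    by (simp add: binomial_ring mult.assoc)
qed simp

text \<open>The shift is split so that \<open>c\<close> goes with \<open>T\<close> and
  \<open>d\<close> with \<open>Z\<close>. The binomial theorem then separates the two independent
  summands, and changing \<open>d\<close> leaves the moments of the \<open>T\<close> part
  untouched.\<close>

lemma expectation_poly_add_indep:
  fixes T Z :: "'a \<Rightarrow> real"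
  assumes TZ: "indep_var borel T borel Z"
    and T: "\<And>n. integrable M (\<lambda>\<omega>. (c + \<i> * of_real (T \<omega>)) ^ n)"
    and Z: "\<And>n. integrable M (\<lambda>\<omega>. (d + \<i> * of_real (Z \<omega>)) ^ n)"
  shows "(\<integral>\<omega>. poly p (c + d + \<i> * of_real (T \<omega> + Z \<omega>)) \<partial>M)
    = (\<Sum>n\<le>degree p. \<Sum>k\<le>n. coeff p n * (of_nat (n choose k) *
        ((\<integral>\<omega>. (c + \<i> * of_real (T \<omega>)) ^ k \<partial>M) * (\<integral>\<omega>. (d + \<i> * of_real (Z \<omega>)) ^ (n - k) \<partial>M))))"
proof -
  have ind: "indep_var borel (\<lambda>\<omega>. (c + \<i> * of_real (T \<omega>)) ^ k) borel (\<lambda>\<omega>. (d + \<i> * of_real (Z \<omega>)) ^ j)" for j k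
    by (rule indep_var_compose_borel[OF TZ]) auto
  have int: "integrable M (\<lambda>\<omega>. coeff p n * (of_nat (n choose k) *
      ((c + \<i> * of_real (T \<omega>)) ^ k * (d + \<i> * of_real (Z \<omega>)) ^ (n - k))))" for n k
    by (intro integrable_mult_right indep_var_integrable[OF ind] T Z)
  have "poly p (c + d + \<i> * of_real (T \<omega> + Z \<omega>))
      = (\<Sum>n\<le>degree p. \<Sum>k\<le>n. coeff p n * (of_nat (n choose k) *
          ((c + \<i> * of_real (T \<omega>)) ^ k * (d + \<i> * of_real (Z \<omega>)) ^ (n - k))))" for \<omega>
  proof -
    have "c + d + \<i> * of_real (T \<omega> + Z \<omega>) = (c + \<i> * of_real (T \<omega>)) + (d + \<i> * of_real (Z \<omega>))"
      by (simp add: algebra_simps)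
    then show ?thesis
      by (simp only: poly_altdef binomial_ring[of "c + \<i> * of_real (T \<omega>)" "d + \<i> * of_real (Z \<omega>)"]
          sum_distrib_left mult.assoc)
  qed
  then show ?thesis
    by (simp add: Bochner_Integration.integral_sum int indep_var_lebesgue_integral[OF ind T Z])
qed

text \<open>The two disjoint events already carry the whole mass 1/2 + 1/2.\<close>

lemma AE_rademacher:
  fixes X :: "'a \<Rightarrow> int"
  assumes [measurable]: "X \<in> measurable M (count_space UNIV)"
    and p: "prob {\<omega> \<in> space M. X \<omega> = 1} = 1 / 2" "prob {\<omega> \<in> space M. X \<omega> = - 1} = 1 / 2"
  shows "AE \<omega> in M. X \<omega> = 1 \<or> X \<omega> = - 1"
proof -
  have "prob {\<omega> \<in> space M. X \<omega> = 1 \<or> X \<omega> = - 1}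
      = prob ({\<omega> \<in> space M. X \<omega> = 1} \<union> {\<omega> \<in> space M. X \<omega> = - 1})"
    by (rule arg_cong[where f = prob]) auto
  also have "\<dots> = 1"
    using p by (subst finite_measure_Union) auto
  finally show ?thesis
    by (simp add: prob_Collect_eq_1)
qed

end

subsection \<open>Martingales along the simple random walk\<close>

locale rademacher_walk = prob_space M for M :: "'a measure" +
  fixes \<zeta> :: "nat \<Rightarrow> 'a \<Rightarrow> int"
  assumes indep: "indep_vars (\<lambda>_. count_space UNIV) \<zeta> {1..}"
    and prob_1: "k \<ge> 1 \<Longrightarrow> prob {\<omega> \<in> space M. \<zeta> k \<omega> = 1} = 1 / 2"
    and prob_m1: "k \<ge> 1 \<Longrightarrow> prob {\<omega> \<in> space M. \<zeta> k \<omega> = - 1} = 1 / 2"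
begin

lemma measurable_step: "k \<ge> 1 \<Longrightarrow> \<zeta> k \<in> measurable M (count_space UNIV)"
  using indep by (auto simp: indep_vars_def)

lemma AE_step: "k \<ge> 1 \<Longrightarrow> AE \<omega> in M. \<zeta> k \<omega> = 1 \<or> \<zeta> k \<omega> = - 1"
  by (intro AE_rademacher measurable_step prob_1 prob_m1)

lemma measurable_walk_filtration:
  "walk \<zeta> t \<in> measurable (generated_filtration M \<zeta> t) (count_space UNIV)"
  by (intro measurable_walk measurable_generated_filtration)

lemma measurable_walk_M [measurable]: "walk \<zeta> t \<in> measurable M (count_space UNIV)"
  by (intro measurable_walk measurable_step) auto

lemma AE_walk_bounded: "AE \<omega> in M. walk \<zeta> t \<omega> \<in> {- int t..int t}"
proof (induction t)
  case (Suc t)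
  have "AE \<omega> in M. \<zeta> (Suc t) \<omega> = 1 \<or> \<zeta> (Suc t) \<omega> = - 1"
    by (rule AE_step) simp
  with Suc show ?case
    by eventually_elim auto
qed simp

text \<open>After \<open>t\<close> steps the walk almost surely lies in a finite set, on which every
  \<open>g\<close> is bounded.\<close>

lemma integrable_walk: "integrable M (\<lambda>\<omega>. g (walk \<zeta> t \<omega>))"
  for g :: "int \<Rightarrow> complex"
proof (rule integrable_const_bound)
  show "AE \<omega> in M. norm (g (walk \<zeta> t \<omega>)) \<le> (\<Sum>i\<in>{- int t..int t}. norm (g i))"
    using AE_walk_bounded[of t] by eventually_elim (intro member_le_sum, auto)
  show "(\<lambda>\<omega>. g (walk \<zeta> t \<omega>)) \<in> borel_measurable M"
    by (rule measurable_compose[OF measurable_walk_M]) simp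
qed

text \<open>Both \<open>A\<close> and the position at time \<open>t\<close> depend on the first
  \<open>t\<close> steps only, so the next step is independent of them and the event that it equals
  \<open>e\<close> contributes the factor 1/2.\<close>

lemma integral_step:
  fixes h :: "int \<Rightarrow> complex"
  assumes A: "A \<in> sets (generated_filtration M \<zeta> t)"
    and e: "prob {\<omega> \<in> space M. \<zeta> (Suc t) \<omega> = e} = 1 / 2"
  shows "(\<integral>\<omega>. indicator A \<omega> *\<^sub>R h (walk \<zeta> t \<omega>) * indicator {e} (\<zeta> (Suc t) \<omega>) \<partial>M)
    = (\<integral>\<omega>. indicator A \<omega> *\<^sub>R h (walk \<zeta> t \<omega>) \<partial>M) / 2"
    and "integrable M (\<lambda>\<omega>. indicator A \<omega> *\<^sub>R h (walk \<zeta> t \<omega>) * indicator {e} (\<zeta> (Suc t) \<omega>))"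
proof -
  let ?V = "\<lambda>K \<omega>. restrict (\<lambda>k. \<zeta> k \<omega>) K"
  let ?N = "\<lambda>K::nat set. PiM K (\<lambda>_. count_space UNIV) :: (nat \<Rightarrow> int) measure"
  obtain A' where A'[measurable]: "A' \<in> sets (?N {1..t})" and AA': "A = ?V {1..t} -` A' \<inter> space M"
    using generated_filtration_vimage[OF A] by blast
  have A_M: "A \<in> sets M"
    using A subalgebra_generated_filtration[of \<zeta> M t, OF measurable_step] by (auto simp: subalgebra_def)
  \<comment> \<open>Replacing \<open>A\<close> by \<open>A'\<close> makes \<open>Y\<close> a
    function of the step vector everywhere; it agrees with the original integrand on
    \<open>space M\<close>.\<close>
  define Y where "Y \<omega> = indicator A' (?V {1..t} \<omega>) *\<^sub>R h (walk \<zeta> t \<omega>)" for \<omega>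
  define W where "W \<omega> = (indicator {e} (\<zeta> (Suc t) \<omega>) :: complex)" for \<omega>
  have Y: "indicator A \<omega> *\<^sub>R h (walk \<zeta> t \<omega>) = Y \<omega>" if "\<omega> \<in> space M" for \<omega>
    using that by (auto simp: Y_def AA' indicator_def)
  have "indep_var (?N {1..t}) (?V {1..t}) (?N {Suc t}) (?V {Suc t})"
    by (rule indep_var_restrict[OF indep]) auto
  \<comment> \<open>The walk of the coordinate maps is the partial sum as a functional on step
    vectors.\<close>
  then have "indep_var borel ((\<lambda>v. indicator A' v *\<^sub>R h (walk (\<lambda>k v. v k) t v)) \<circ> ?V {1..t})
      borel ((\<lambda>v. indicator {e} (v (Suc t)) :: complex) \<circ> ?V {Suc t})"
  proof (rule indep_var_compose)
    have "walk (\<lambda>k v. v k) t \<in> measurable (?N {1..t}) (count_space UNIV)"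
      by (intro measurable_walk measurable_component_singleton) auto
    then have "(\<lambda>v. h (walk (\<lambda>k v. v k) t v)) \<in> borel_measurable (?N {1..t})"
      by (rule measurable_compose) simp
    then show "(\<lambda>v. indicator A' v *\<^sub>R h (walk (\<lambda>k v. v k) t v)) \<in> borel_measurable (?N {1..t})"
      by measurable
    have "(\<lambda>v. v (Suc t)) \<in> measurable (?N {Suc t}) (count_space UNIV)"
      by (rule measurable_component_singleton) simp
    then show "(\<lambda>v. indicator {e} (v (Suc t)) :: complex) \<in> borel_measurable (?N {Suc t})"
      by (rule measurable_compose) simp
  qed
  moreover have "(\<lambda>v. indicator A' v *\<^sub>R h (walk (\<lambda>k v. v k) t v)) \<circ> ?V {1..t} = Y"
    by (auto simp: Y_def fun_eq_iff walk_def intro!: arg_cong[where f = h] sum.cong)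
  moreover have "(\<lambda>v. indicator {e} (v (Suc t)) :: complex) \<circ> ?V {Suc t} = W"
    by (simp add: W_def fun_eq_iff)
  ultimately have ind: "indep_var borel Y borel W"
    by simp
  have int_Y: "integrable M Y"
    using integrable_mult_indicator[OF A_M integrable_walk[of h t]] Y
    by (simp cong: Bochner_Integration.integrable_cong)
  let ?E = "{\<omega> \<in> space M. \<zeta> (Suc t) \<omega> = e}"
  have E: "?E \<in> sets M"
    using measurable_sets[OF measurable_step[of "Suc t"], of "{e}"] by (simp add: vimage_def Int_def conj_commute)
  have W: "W \<omega> = complex_of_real (indicator ?E \<omega>)" if "\<omega> \<in> space M" for \<omega>
    using that by (auto simp: W_def indicator_def)
  have "integrable M (\<lambda>\<omega>. complex_of_real (indicator ?E \<omega>))"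
    using E by (intro integrable_of_real integrable_real_indicator) (auto simp: less_top[symmetric])
  then have int_W: "integrable M W"
    using W by (simp only: cong: Bochner_Integration.integrable_cong)
  have "(\<integral>\<omega>. W \<omega> \<partial>M) = (\<integral>\<omega>. complex_of_real (indicator ?E \<omega>) \<partial>M)"
    using W by (rule Bochner_Integration.integral_cong[OF refl])
  also have "\<dots> = complex_of_real (prob ?E)"
    using E by (simp only: integral_complex_of_real) simp
  also have "\<dots> = 1 / 2"
    by (simp add: e)
  finally have W_half: "(\<integral>\<omega>. W \<omega> \<partial>M) = 1 / 2" .
  have "(\<integral>\<omega>. indicator A \<omega> *\<^sub>R h (walk \<zeta> t \<omega>) * indicator {e} (\<zeta> (Suc t) \<omega>) \<partial>M) = (\<integral>\<omega>. Y \<omega> * W \<omega> \<partial>M)"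
    using Y by (intro Bochner_Integration.integral_cong) (auto simp: W_def)
  also have "\<dots> = (\<integral>\<omega>. Y \<omega> \<partial>M) / 2"
    by (simp add: indep_var_lebesgue_integral[OF ind int_Y int_W] W_half)
  also have "(\<integral>\<omega>. Y \<omega> \<partial>M) = (\<integral>\<omega>. indicator A \<omega> *\<^sub>R h (walk \<zeta> t \<omega>) \<partial>M)"
    using Y by (intro Bochner_Integration.integral_cong) auto
  finally show "(\<integral>\<omega>. indicator A \<omega> *\<^sub>R h (walk \<zeta> t \<omega>) * indicator {e} (\<zeta> (Suc t) \<omega>) \<partial>M)
    = (\<integral>\<omega>. indicator A \<omega> *\<^sub>R h (walk \<zeta> t \<omega>) \<partial>M) / 2" .
  have "integrable M (\<lambda>\<omega>. Y \<omega> * W \<omega>)"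
    by (rule indep_var_integrable[OF ind int_Y int_W])
  then show "integrable M (\<lambda>\<omega>. indicator A \<omega> *\<^sub>R h (walk \<zeta> t \<omega>) * indicator {e} (\<zeta> (Suc t) \<omega>))"
    using Y by (simp add: W_def cong: Bochner_Integration.integrable_cong)
qed

text \<open>The integral is split by the value of the next step. Each value has weight 1/2, and the
  mean of the two shifted functions is \<open>g\<close> by the averaging hypothesis.\<close>

lemma set_integral_walk_Suc:
  fixes g g' :: "int \<Rightarrow> complex"
  assumes A: "A \<in> sets (generated_filtration M \<zeta> t)"
    and g: "\<And>x. g' (x + 1) + g' (x - 1) = 2 * g x"
  shows "(\<integral>\<omega>\<in>A. g' (walk \<zeta> (Suc t) \<omega>) \<partial>M) = (\<integral>\<omega>\<in>A. g (walk \<zeta> t \<omega>) \<partial>M)"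
proof -
  let ?S = "walk \<zeta> t"
  have A_M[measurable]: "A \<in> sets M"
    using A subalgebra_generated_filtration[of \<zeta> M t, OF measurable_step] by (auto simp: subalgebra_def)
  have int: "integrable M (\<lambda>\<omega>. indicator A \<omega> *\<^sub>R h (?S \<omega>))" for h :: "int \<Rightarrow> complex"
    by (rule integrable_mult_indicator[OF A_M integrable_walk])
  have p: "prob {\<omega> \<in> space M. \<zeta> (Suc t) \<omega> = 1} = 1 / 2" "prob {\<omega> \<in> space M. \<zeta> (Suc t) \<omega> = - 1} = 1 / 2"
    using prob_1 prob_m1 by simp_all
  note step = integral_step[OF A p(1), of "\<lambda>x. g' (x + 1)"] integral_step[OF A p(2), of "\<lambda>x. g' (x - 1)"]
  have "AE \<omega> in M. \<zeta> (Suc t) \<omega> = 1 \<or> \<zeta> (Suc t) \<omega> = - 1"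
    by (rule AE_step) simp
  \<comment> \<open>The decomposition holds only almost everywhere, since on a null set the step may
    take other values.\<close>
  then have "AE \<omega> in M. indicator A \<omega> *\<^sub>R g' (walk \<zeta> (Suc t) \<omega>)
      = indicator A \<omega> *\<^sub>R g' (?S \<omega> + 1) * indicator {1} (\<zeta> (Suc t) \<omega>)
        + indicator A \<omega> *\<^sub>R g' (?S \<omega> - 1) * indicator {- 1} (\<zeta> (Suc t) \<omega>)"
    by eventually_elim auto
  then have "(\<integral>\<omega>\<in>A. g' (walk \<zeta> (Suc t) \<omega>) \<partial>M)
      = (\<integral>\<omega>. indicator A \<omega> *\<^sub>R g' (?S \<omega> + 1) * indicator {1} (\<zeta> (Suc t) \<omega>)
        + indicator A \<omega> *\<^sub>R g' (?S \<omega> - 1) * indicator {- 1} (\<zeta> (Suc t) \<omega>) \<partial>M)"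
    unfolding set_lebesgue_integral_def
    by (intro integral_cong_AE borel_measurable_integrable Bochner_Integration.integrable_add step
        integrable_mult_indicator[OF A_M integrable_walk])
  also have "\<dots> = (\<integral>\<omega>. indicator A \<omega> *\<^sub>R g' (?S \<omega> + 1) \<partial>M) / 2 + (\<integral>\<omega>. indicator A \<omega> *\<^sub>R g' (?S \<omega> - 1) \<partial>M) / 2"
    by (simp only: Bochner_Integration.integral_add[OF step(2) step(4)] step(1) step(3))
  also have "\<dots> = (\<integral>\<omega>. indicator A \<omega> *\<^sub>R g' (?S \<omega> + 1) + indicator A \<omega> *\<^sub>R g' (?S \<omega> - 1) \<partial>M) / 2"
    by (subst Bochner_Integration.integral_add[OF int int]) (simp add: add_divide_distrib)
  also have "\<dots> = (\<integral>\<omega>. 2 * (indicator A \<omega> *\<^sub>R g (?S \<omega>)) \<partial>M) / 2"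
    by (simp only: g mult_scaleR_right flip: scaleR_add_right)
  also have "\<dots> = (\<integral>\<omega>. indicator A \<omega> *\<^sub>R g (?S \<omega>) \<partial>M)"
    by (simp only: integral_mult_right_zero) simp
  finally show ?thesis
    by (simp add: set_lebesgue_integral_def)
qed

text \<open>The hypothesis says that \<open>G\<close> is space-time harmonic for the walk. Integrals
  over a fixed event of time \<open>s\<close> are therefore preserved at each step from
  \<open>s\<close> to \<open>t\<close>, because the event stays in the later sigma-algebras. This
  characterises the conditional expectations of the real and imaginary parts.\<close>

lemma complex_martingale_walk:
  fixes G :: "nat \<Rightarrow> int \<Rightarrow> complex"
  assumes G: "\<And>t x. G (Suc t) (x + 1) + G (Suc t) (x - 1) = 2 * G t x"
  shows "complex_martingale M (generated_filtration M \<zeta>) (\<lambda>t \<omega>. G t (walk \<zeta> t \<omega>))"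
  unfolding complex_martingale_def
proof (intro conjI allI impI)
  let ?F = "generated_filtration M \<zeta>"
  show "filtration (space M) ?F"
    by (rule filtration_generated_filtration)
  show sub: "subalgebra M (?F t)" for t
    by (rule subalgebra_generated_filtration[OF measurable_step])
  show meas: "(\<lambda>\<omega>. G t (walk \<zeta> t \<omega>)) \<in> borel_measurable (?F t)" for t
    by (rule measurable_compose[OF measurable_walk_filtration]) simp
  show int: "integrable M (\<lambda>\<omega>. G t (walk \<zeta> t \<omega>))" for t
    by (rule integrable_walk)
  fix s t :: nat assume "s \<le> t"
  then have eq: "(\<integral>\<omega>\<in>A. G t (walk \<zeta> t \<omega>) \<partial>M) = (\<integral>\<omega>\<in>A. G s (walk \<zeta> s \<omega>) \<partial>M)"
    if A: "A \<in> sets (?F s)" for A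
  proof (induction rule: dec_induct)
    case (step n)
    have "A \<in> sets (?F n)"
      using A filtration.sets_F_mono[OF filtration_generated_filtration \<open>s \<le> n\<close>] by blast
    then show ?case
      using set_integral_walk_Suc[of A n "G (Suc n)" "G n", OF _ G] step by simp
  qed simp
  interpret finite_measure_subalgebra M "?F s"
    by unfold_locales (rule sub)
  have A_M: "A \<in> sets M" if "A \<in> sets (?F s)" for A
    using that sub[of s] by (auto simp: subalgebra_def)
  have int_A: "integrable M (\<lambda>\<omega>. indicator A \<omega> *\<^sub>R G t (walk \<zeta> t \<omega>))" if "A \<in> sets (?F s)" for A t
    by (rule integrable_mult_indicator[OF A_M[OF that] int])
  have "AE \<omega> in M. real_cond_exp M (?F s) (\<lambda>\<eta>. Re (G t (walk \<zeta> t \<eta>))) \<omega> = Re (G s (walk \<zeta> s \<omega>))"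
  proof (rule real_cond_exp_charact)
    fix A assume A: "A \<in> sets (?F s)"
    show "(\<integral>\<omega>\<in>A. Re (G t (walk \<zeta> t \<omega>)) \<partial>M) = (\<integral>\<omega>\<in>A. Re (G s (walk \<zeta> s \<omega>)) \<partial>M)"
      using arg_cong[OF eq[OF A], of Re] integral_Re[OF int_A[OF A]]
      by (simp add: set_lebesgue_integral_def)
  qed (use int meas in auto)
  moreover have "AE \<omega> in M. real_cond_exp M (?F s) (\<lambda>\<eta>. Im (G t (walk \<zeta> t \<eta>))) \<omega> = Im (G s (walk \<zeta> s \<omega>))"
  proof (rule real_cond_exp_charact)
    fix A assume A: "A \<in> sets (?F s)"
    show "(\<integral>\<omega>\<in>A. Im (G t (walk \<zeta> t \<omega>)) \<partial>M) = (\<integral>\<omega>\<in>A. Im (G s (walk \<zeta> s \<omega>)) \<partial>M)"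
      using arg_cong[OF eq[OF A], of Im] integral_Im[OF int_A[OF A]]
      by (simp add: set_lebesgue_integral_def)
  qed (use int meas in auto)
  ultimately show "AE \<omega> in M. complex_cond_exp M (?F s) (\<lambda>\<omega>. G t (walk \<zeta> t \<omega>)) \<omega> = G s (walk \<zeta> s \<omega>)"
    by eventually_elim (simp add: complex_cond_exp_def)
qed

end

section \<open>The averaging identity along the hyperbolic secant walk\<close>

text \<open>The last step is separated from the first \<open>t\<close> steps. Adding the shifts 1
  and -1 removes all its moments of positive order, so what remains is the same expectation one step
  earlier.\<close>

lemma (in prob_space) expectation_sech_walk_Suc:
  fixes Z :: "nat \<Rightarrow> 'a \<Rightarrow> real"
  assumes Z: "indep_vars (\<lambda>_. borel) Z {1..}"
    and sech: "\<And>k. k \<ge> 1 \<Longrightarrow> distributed M lborel (Z k) (\<lambda>x. ennreal (sech_density x))"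
  shows "(\<integral>\<omega>. poly f (c + 1 + \<i> * of_real (walk Z (Suc t) \<omega>)) \<partial>M)
      + (\<integral>\<omega>. poly f (c - 1 + \<i> * of_real (walk Z (Suc t) \<omega>)) \<partial>M)
    = 2 * (\<integral>\<omega>. poly f (c + \<i> * of_real (walk Z t \<omega>)) \<partial>M)"
proof -
  let ?T = "\<lambda>\<omega>. complex_of_real (walk Z t \<omega>)" and ?X = "\<lambda>\<omega>. complex_of_real (Z (Suc t) \<omega>)"
  have X: "distributed M lborel (Z (Suc t)) (\<lambda>x. ennreal (sech_density x))"
    using sech by simp
  have int_T: "integrable M (\<lambda>\<omega>. (c + \<i> * ?T \<omega>) ^ n)" for n
    using integrable_poly_of_moments[OF integrable_walk_power[OF Z integrable_sech_power[OF sech]], where p = "monom 1 n" and c = c]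
    by (simp add: poly_monom)
  have int_X: "integrable M (\<lambda>\<omega>. (d + \<i> * ?X \<omega>) ^ n)" for d n
    using integrable_sech_poly[OF X, of "monom 1 n" d] by (simp add: poly_monom)
  define A where "A k = (\<integral>\<omega>. (c + \<i> * ?T \<omega>) ^ k \<partial>M)" for k
  define B where "B d k = (\<integral>\<omega>. (d + \<i> * ?X \<omega>) ^ k \<partial>M)" for d k
  \<comment> \<open>The identity for one secant variable, applied to the monomial of degree
    \<open>k\<close>, whose value at 0 is 1 or 0.\<close>
  have B: "B 1 k + B (-1) k = (if k = 0 then 2 else 0)" for k
    using expectation_sech_poly[OF X, of "monom 1 k"] by (simp add: B_def poly_monom power_0_left)
  have step: "(\<integral>\<omega>. poly f (c + d + \<i> * of_real (walk Z (Suc t) \<omega>)) \<partial>M)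
      = (\<Sum>n\<le>degree f. \<Sum>k\<le>n. coeff f n * (of_nat (n choose k) * (A k * B d (n - k))))" for d
    unfolding A_def B_def walk_Suc
    by (rule expectation_poly_add_indep[OF indep_var_walk_step[OF Z] int_T int_X])
  have "(\<Sum>n\<le>degree f. \<Sum>k\<le>n. coeff f n * (of_nat (n choose k) * (A k * B 1 (n - k))))
      + (\<Sum>n\<le>degree f. \<Sum>k\<le>n. coeff f n * (of_nat (n choose k) * (A k * B (-1) (n - k))))
      = (\<Sum>n\<le>degree f. \<Sum>k\<le>n. coeff f n * (of_nat (n choose k) * (A k * (B 1 (n - k) + B (-1) (n - k)))))"
    by (simp only: distrib_left sum.distrib)
  \<comment> \<open>In the range of summation, the exponent \<open>n - k\<close> vanishes exactly
    for \<open>k = n\<close>.\<close>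
  also have "\<dots> = (\<Sum>n\<le>degree f. \<Sum>k\<le>n. if k = n then 2 * (coeff f n * A n) else 0)"
    by (intro sum.cong) (auto simp: B)
  also have "\<dots> = 2 * (\<Sum>n\<le>degree f. coeff f n * A n)"
    by (simp add: sum_distrib_left)
  also have "(\<Sum>n\<le>degree f. coeff f n * A n) = (\<integral>\<omega>. (\<Sum>n\<le>degree f. coeff f n * (c + \<i> * ?T \<omega>) ^ n) \<partial>M)"
    unfolding A_def by (simp only: Bochner_Integration.integral_sum integrable_mult_right int_T integral_mult_right_zero)
  finally show ?thesis
    using step[of 1] step[of "-1"] by (simp only: poly_altdef[symmetric] diff_conv_add_uminus)
qed

theorem lemma2p3:
  fixes M :: "'a measure"
    and \<zeta> :: "nat \<Rightarrow> 'a \<Rightarrow> int"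
    and \<zeta>' :: "nat \<Rightarrow> 'a \<Rightarrow> real"
    and f :: "complex poly"
  assumes "prob_space M"
    and "prob_space.indep_vars M (\<lambda>_. count_space UNIV) \<zeta> {1..}"
    and "\<And>k. k \<ge> 1 \<Longrightarrow> measure M {\<omega> \<in> space M. \<zeta> k \<omega> = 1} = 1 / 2"
    and "\<And>k. k \<ge> 1 \<Longrightarrow> measure M {\<omega> \<in> space M. \<zeta> k \<omega> = - 1} = 1 / 2"
    and "prob_space.indep_vars M (\<lambda>_. borel) \<zeta>' {1..}"
    and "\<And>k. k \<ge> 1 \<Longrightarrow> distributed M lborel (\<zeta>' k) (\<lambda>x. ennreal (sech_density x))"
    and "prob_space.indep_var M
           (PiM UNIV (\<lambda>_. borel)) (\<lambda>\<omega> t. real_of_int (walk \<zeta> t \<omega>))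
           (PiM UNIV (\<lambda>_. borel)) (\<lambda>\<omega> t. walk \<zeta>' t \<omega>)"
  shows "complex_martingale M (generated_filtration M \<zeta>)
           (expectation_tilde M (walk \<zeta>) (walk \<zeta>') (poly f))"
proof -
  interpret prob_space M
    by (rule assms(1))
  interpret rademacher_walk M \<zeta>
    by unfold_locales (use assms(2-4) in auto)
  \<comment> \<open>With the position frozen at \<open>x\<close>, the partial expectation is a
    function of time and \<open>x\<close>, evaluated at the walk. The averaging identity, with
    \<open>c\<close> the integer \<open>x\<close>, is its harmonicity.\<close>
  have "complex_martingale M (generated_filtration M \<zeta>) (\<lambda>t \<omega>.
      (\<lambda>t x. \<integral>\<eta>. poly f (of_int x + \<i> * complex_of_real (walk \<zeta>' t \<eta>)) \<partial>M) t (walk \<zeta> t \<omega>))"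
    using expectation_sech_walk_Suc[OF assms(5,6), of f]
    by (intro complex_martingale_walk) (simp only: of_int_add of_int_diff of_int_1)
  then show ?thesis
    by (simp add: expectation_tilde_def[abs_def])
qed

end
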